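(* Let $V$ be an $n$-dimensional rational representation of a linear group $G$. (1) For every $m\geq 1$, all $G$-invariant $m$-ary forms can be recovered from the $(G\times U_m)$-invariant ones by polarization: $$\mathbb{R}[V^m]^G=\big\langle \mathrm{GL}(m)\ast \mathbb{R}[V^m]^{G\times U_m}\big\rangle.$$ (2) For every $m\geq 1$, $$\mathbb{R}[V^m]^{U_m}=\mathbb{R}[V^m]\cap\mathbb{R}[V^n]^{U_n}.$$ (3) Consequently, if $m\ge n$ then $$\mathbb{R}[V^m]^G=\big\langle \mathrm{GL}(m)\ast\mathbb{R}[V^n]^G\big\rangle,$$ and if $m\le n$ then the $G$-invariant $m$-ary forms are recovered from the $G$-invariant $n$-ary forms by restriction, i.e. $\mathbb{R}[V^m]^G=\mathbb{R}[V^m]\cap\mathbb{R}[V^n]^G$.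
   Context: A linear group is a closed matrix group $G\subseteq \mathrm{GL}(r)=\mathrm{GL}(r,\mathbb{R})$. A representation $\rho\colon G\to\mathrm{GL}(V)$ on a real vector space is rational if the matrix coefficients of $\rho(g)$ are regular functions of $g$, i.e. restrictions to $G$ of elements of $\mathbb{R}[\mathrm{M}_r][\det^{-1}]$. $G$ acts diagonally on $V^m$ and on $\mathbb{R}[V^m]$ (polynomial functions on $V^m$) by $(g\ast f)(x)=f(g^{-1}\ast x)$. In a basis of $V$, an element $(v_1,\dots,v_m)\in V^m$ is the $n\times m$ matrix $\mathbf{M}$ with columns $v_1,\dots,v_m$; the group $\mathrm{GL}(m)$ acts on $\mathbb{R}[V^m]$ by $(\gamma\ast f)(\mathbf{M})=f(\mathbf{M}\gamma)$, and this commutes with the $G$-action. $U_m\subset\mathrm{GL}(m)$ is the subgroup of upper triangular matrices with ones on the diagonal. For a group acting on a space, the superscript denotes the subspace of invariants; $\mathbb{R}[V^m]^{G\times U_m}$ consists of the polynomials invariant under both $G$ and $U_m$. For $p\le q$, $\mathbb{R}[V^p]$ is regarded as the subspace of $\mathbb{R}[V^q]$ of polynomials depending only on the first $p$ vector variables; intersections are taken in $\mathbb{R}[V^{\max(m,n)}]$. For a subset $S$ of a representation of a group $\Gamma$, $\langle\Gamma\ast S\rangle$ is the linear span of $\{\gamma\ast s:\gamma\in\Gamma,s\in S\}$. *)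

theory Defs
  imports
    "HOL-Analysis.Analysis"
    "HOL-Library.Function_Algebras"
    "Jordan_Normal_Form.Matrix"
begin

hide_const (open) Matrix.mat

definition linear_group :: "(real^'r^'r) set \<Rightarrow> bool" where
  "linear_group G \<longleftrightarrow>
     G \<subseteq> {A. invertible A} \<and>
     mat 1 \<in> G \<and> (\<forall>A\<in>G. \<forall>B\<in>G. A ** B \<in> G) \<and> (\<forall>A\<in>G. matrix_inv A \<in> G) \<and>
     closedin (top_of_set {A. invertible A}) G"

definition regular_on :: "(real^'r^'r) set \<Rightarrow> (real^'r^'r \<Rightarrow> real) \<Rightarrow> bool" where
  "regular_on G h \<longleftrightarrow>
     (\<exists>p k. real_polynomial_function p \<and> (\<forall>A\<in>G. h A = p A / det A ^ k))"

definition rational_representation ::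
    "(real^'r^'r) set \<Rightarrow> (real^'r^'r \<Rightarrow> 'v::real_vector \<Rightarrow> 'v) \<Rightarrow> bool" where
  "rational_representation G \<rho> \<longleftrightarrow>
     (\<forall>A\<in>G. linear (\<rho> A) \<and> bij (\<rho> A)) \<and>
     (\<forall>A\<in>G. \<forall>B\<in>G. \<rho> (A ** B) = \<rho> A \<circ> \<rho> B) \<and>
     (\<forall>\<phi> v. linear \<phi> \<longrightarrow> regular_on G (\<lambda>A. \<phi> (\<rho> A v)))"

text \<open>
  Polynomial functions on \<open>V\<^sup>m\<close> are encoded as functions of an infinite sequence
  of vectors that involve only its first \<open>m\<close> members. With this encoding
  \<open>poly_funs p\<close> is literally a subset of \<open>poly_funs q\<close> for \<open>p \<le> q\<close>; see
  \<open>poly_funs_le_eq\<close>. Vector variables are numbered from 0.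
\<close>

inductive_set poly_funs :: "nat \<Rightarrow> ((nat \<Rightarrow> 'v::real_vector) \<Rightarrow> real) set" for m where
  linear: "i < m \<Longrightarrow> linear \<phi> \<Longrightarrow> (\<lambda>x. \<phi> (x i)) \<in> poly_funs m"
| const: "(\<lambda>x. c) \<in> poly_funs m"
| add: "f \<in> poly_funs m \<Longrightarrow> g \<in> poly_funs m \<Longrightarrow> (\<lambda>x. f x + g x) \<in> poly_funs m"
| mult: "f \<in> poly_funs m \<Longrightarrow> g \<in> poly_funs m \<Longrightarrow> (\<lambda>x. f x * g x) \<in> poly_funs m"

lemma poly_funs_le_eq:
  assumes "p \<le> q"
  shows "poly_funs p =
    {f \<in> poly_funs q. \<forall>x y. (\<forall>i<p. x i = y i) \<longrightarrow> f x = f y}"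
proof (intro equalityI subsetI)
  fix f :: "(nat \<Rightarrow> 'v::real_vector) \<Rightarrow> real"
  assume "f \<in> poly_funs p"
  then show "f \<in> {f \<in> poly_funs q. \<forall>x y. (\<forall>i<p. x i = y i) \<longrightarrow> f x = f y}"
  proof induction
    case (linear i \<phi>)
    then show ?case using assms by (auto intro: poly_funs.linear)
  next
    case (const c)
    then show ?case by (auto intro: poly_funs.const)
  next
    case (add f g)
    then show ?case by (simp add: poly_funs.add) metis
  next
    case (mult f g)
    then show ?case by (simp add: poly_funs.mult) metis
  qed
next
  fix f :: "(nat \<Rightarrow> 'v::real_vector) \<Rightarrow> real"
  assume f: "f \<in> {f \<in> poly_funs q. \<forall>x y. (\<forall>i<p. x i = y i) \<longrightarrow> f x = f y}"
  let ?t = "\<lambda>(x::nat \<Rightarrow> 'v) i. if i < p then x i else 0"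
  from f have "f \<in> poly_funs q" by simp
  then have "(\<lambda>x. f (?t x)) \<in> poly_funs p"
  proof induction
    case (linear i \<phi>)
    show ?case
    proof (cases "i < p")
      case True
      then show ?thesis using linear by (simp add: poly_funs.linear)
    next
      case False
      then show ?thesis by (simp add: poly_funs.const)
    qed
  qed (simp_all add: poly_funs.intros)
  moreover have "(\<lambda>x. f (?t x)) = f"
  proof
    fix x
    show "f (?t x) = f x" using f by simp
  qed
  ultimately show "f \<in> poly_funs p" by simp
qed

definition G_act ::
    "(real^'r^'r \<Rightarrow> 'v \<Rightarrow> 'v) \<Rightarrow> real^'r^'r \<Rightarrow> ((nat \<Rightarrow> 'v) \<Rightarrow> real) \<Rightarrow> (nat \<Rightarrow> 'v) \<Rightarrow> real" where
  "G_act \<rho> A f = (\<lambda>x. f (\<lambda>i. \<rho> (matrix_inv A) (x i)))"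

definition GL :: "nat \<Rightarrow> real mat set" where
  "GL m = {\<gamma> \<in> carrier_mat m m. invertible_mat \<gamma>}"

definition U :: "nat \<Rightarrow> real mat set" where
  "U m = {\<gamma> \<in> GL m. upper_triangular \<gamma> \<and> (\<forall>i<m. \<gamma> $$ (i, i) = 1)}"

text \<open>
  Column \<open>j\<close> of the matrix product \<open>M\<gamma>\<close>, where the columns of \<open>M\<close> are
  \<open>x 0, \<dots>, x (m - 1)\<close>; the values beyond position \<open>m\<close> are irrelevant to \<open>poly_funs m\<close>.
\<close>

definition right_mult :: "nat \<Rightarrow> (nat \<Rightarrow> 'v::real_vector) \<Rightarrow> real mat \<Rightarrow> nat \<Rightarrow> 'v" where
  "right_mult m x \<gamma> = (\<lambda>j. if j < m then \<Sum>i<m. \<gamma> $$ (i, j) *\<^sub>R x i else x j)"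

definition GL_act ::
    "nat \<Rightarrow> real mat \<Rightarrow> ((nat \<Rightarrow> 'v::real_vector) \<Rightarrow> real) \<Rightarrow> (nat \<Rightarrow> 'v) \<Rightarrow> real" where
  "GL_act m \<gamma> f = (\<lambda>x. f (right_mult m x \<gamma>))"

definition G_invs ::
    "(real^'r^'r) set \<Rightarrow> (real^'r^'r \<Rightarrow> 'v::real_vector \<Rightarrow> 'v) \<Rightarrow> nat
      \<Rightarrow> ((nat \<Rightarrow> 'v) \<Rightarrow> real) set" where
  "G_invs G \<rho> m = {f \<in> poly_funs m. \<forall>A\<in>G. G_act \<rho> A f = f}"

definition U_invs :: "nat \<Rightarrow> ((nat \<Rightarrow> 'v::real_vector) \<Rightarrow> real) set" where
  "U_invs m = {f \<in> poly_funs m. \<forall>\<gamma>\<in>U m. GL_act m \<gamma> f = f}"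

definition GU_invs ::
    "(real^'r^'r) set \<Rightarrow> (real^'r^'r \<Rightarrow> 'v::real_vector \<Rightarrow> 'v) \<Rightarrow> nat
      \<Rightarrow> ((nat \<Rightarrow> 'v) \<Rightarrow> real) set" where
  "GU_invs G \<rho> m =
     {f \<in> poly_funs m. (\<forall>A\<in>G. G_act \<rho> A f = f) \<and> (\<forall>\<gamma>\<in>U m. GL_act m \<gamma> f = f)}"

text \<open>
  Function types are not an instance of \<^class>\<open>real_vector\<close>, so the linear span is taken
  with respect to an explicit pointwise scalar multiplication.
\<close>

definition scale_fun :: "real \<Rightarrow> ('a \<Rightarrow> real) \<Rightarrow> 'a \<Rightarrow> real" where
  "scale_fun c f = (\<lambda>x. c * f x)"

global_interpretation real_fun: vector_space scale_fun
  by unfold_locales (auto simp: scale_fun_def fun_eq_iff algebra_simps)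

definition GL_span ::
    "nat \<Rightarrow> ((nat \<Rightarrow> 'v::real_vector) \<Rightarrow> real) set \<Rightarrow> ((nat \<Rightarrow> 'v) \<Rightarrow> real) set" where
  "GL_span m S = real_fun.span {GL_act m \<gamma> f | \<gamma> f. \<gamma> \<in> GL m \<and> f \<in> S}"

end

(* A polynomial is encoded by tensor coefficients, indexed by words in the coordinates of V^m. On
   these the transpose of the action of g in GL(m) is the action of the transpose of g, so the
   orthogonal complement of a GL(m)-stable subspace is GL(m)-stable. The complement of the span of
   the U_m-invariants contains no nonzero U_m-invariant; but a nonzero U_m-stable space contains
   one, because U_m acts unitriangularly for the weight filtration. Hence the complement vanishes.
   For m > n, a U_m-invariant does not change when v_j, j >= n, is replaced by 0 if the first n
   vectors form a basis, and then in general, since a polynomial identity that holds at all far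
   points of a line holds on the whole line. *)
theory Submission
  imports Defs "Jordan_Normal_Form.Determinant"
begin

section \<open>Orthogonal projection for functions on a finite set\<close>

text \<open>Gram-Schmidt, one coordinate at a time. The members of \<open>S\<close> that vanish at
  the new index \<open>j\<close> form a subspace \<open>S0\<close> to which the induction hypothesis
  applies; if \<open>S0\<close> is not all of \<open>S\<close>, a single vector \<open>u\<close>
  orthogonal to \<open>S0\<close> spans the rest.\<close>

lemma subspace_orthogonal_projection:
  assumes "finite I" "real_fun.subspace S"
  shows "\<exists>s\<in>S. \<forall>t\<in>S. (\<Sum>i\<in>I. (w i - s i) * t i) = 0"
  using assms
proof (induction arbitrary: S w rule: finite_induct)
  case empty
  then show ?case using real_fun.subspace_0 by auto
next
  case (insert j I)
  define S0 where "S0 = {t\<in>S. t j = 0}"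
  have S0: "real_fun.subspace S0"
    using insert.prems unfolding S0_def
    by (auto simp: real_fun.subspace_def) (simp add: scale_fun_def)
  have plus: "(\<lambda>i. f i + c * g i) \<in> S" if "f \<in> S" "g \<in> S" for f g c
  proof -
    have "f + scale_fun c g \<in> S"
      using that insert.prems by (auto simp: real_fun.subspace_def)
    then show ?thesis by (simp add: scale_fun_def plus_fun_def)
  qed
  obtain s0 where s0: "s0 \<in> S0" "\<And>t. t \<in> S0 \<Longrightarrow> (\<Sum>i\<in>I. (w i - s0 i) * t i) = 0"
    using insert.IH[OF S0, of w] by auto
  show ?case
  proof (cases "S = S0")
    case True
    then show ?thesis
      using s0 insert.hyps by (intro bexI[of _ s0]) (auto simp: S0_def)
  next
    case False
    then obtain t1 where t1: "t1 \<in> S" "t1 j \<noteq> 0" by (auto simp: S0_def)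
    obtain r where r: "r \<in> S0" "\<And>t. t \<in> S0 \<Longrightarrow> (\<Sum>i\<in>I. (t1 i - r i) * t i) = 0"
      using insert.IH[OF S0, of t1] by auto
    define u where "u = (\<lambda>i. t1 i - r i)"
    have u: "u \<in> S" using plus[of t1 r "-1"] t1 r by (simp add: u_def S0_def)
    have uj: "u j \<noteq> 0" using t1 r by (simp add: u_def S0_def)
    define ip where "ip = (\<lambda>f g::_ \<Rightarrow> real. \<Sum>i\<in>insert j I. f i * g i)"
    have ip_add: "ip f (\<lambda>i. g i + c * h i) = ip f g + c * ip f h" for f g h c
      by (simp add: ip_def algebra_simps sum.distrib sum_distrib_left del: sum.insert sum.insert_if)
    have ip_add': "ip (\<lambda>i. g i + c * h i) f = ip g f + c * ip h f" for f g h c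
      by (simp add: ip_def algebra_simps sum.distrib sum_distrib_left del: sum.insert sum.insert_if)
    have u_orth: "ip u t = 0" if "t \<in> S0" for t
      using r(2)[OF that] that insert.hyps by (simp add: ip_def u_def S0_def)
    have s_orth: "ip (\<lambda>i. w i - s0 i) t = 0" if "t \<in> S0" for t
      using s0(2)[OF that] that insert.hyps by (simp add: ip_def S0_def)
    have uu: "ip u u \<noteq> 0"
    proof -
      have "0 < u j * u j" using uj by (metis not_real_square_gt_zero)
      also have "\<dots> \<le> ip u u"
        unfolding ip_def using insert.hyps by (intro member_le_sum) auto
      finally show ?thesis by simp
    qed
    \<comment> \<open>The coefficient of the projection of the residual \<open>w - s0\<close> onto
      \<open>u\<close>.\<close>
    define c where "c = ip (\<lambda>i. w i - s0 i) u / ip u u"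
    let ?s = "\<lambda>i. s0 i + c * u i"
    have res: "(\<lambda>i. w i - ?s i) = (\<lambda>i. (w i - s0 i) + (-c) * u i)" by auto
    have "ip (\<lambda>i. w i - ?s i) t = 0" if t: "t \<in> S" for t
    proof -
      \<comment> \<open>With this \<open>a\<close>, the vector \<open>t - a u\<close> vanishes at
        \<open>j\<close>; so \<open>S\<close> is the sum of \<open>S0\<close> and the line through
        \<open>u\<close>.\<close>
      define a where "a = t j / u j"
      have "(\<lambda>i. t i + (-a) * u i) \<in> S0"
        using plus[OF t u, of "-a"] uj by (simp add: S0_def a_def)
      then obtain t0 where t0: "t0 \<in> S0" "t0 = (\<lambda>i. t i + (-a) * u i)" by blast
      have "t = (\<lambda>i. t0 i + a * u i)" using t0(2) by auto
      moreover have "ip (\<lambda>i. w i - ?s i) t0 = 0"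
        unfolding res ip_add' using s_orth[OF t0(1)] u_orth[OF t0(1)] by simp
      moreover have "ip (\<lambda>i. w i - ?s i) u = 0"
        unfolding res ip_add' using uu by (simp add: c_def)
      ultimately show ?thesis by (simp only: ip_add)
    qed
    moreover have "?s \<in> S" using plus[OF _ u, of s0 c] s0 by (simp add: S0_def)
    ultimately show ?thesis unfolding ip_def by (intro bexI[of _ ?s]) auto
  qed
qed

section \<open>Polynomial functions and the group actions\<close>

lemma poly_funs_mono: "p \<le> q \<Longrightarrow> poly_funs p \<subseteq> poly_funs q"
  using poly_funs_le_eq by blast

lemma poly_funs_cong:
  "f \<in> poly_funs p \<Longrightarrow> (\<And>i. i < p \<Longrightarrow> x i = y i) \<Longrightarrow> f x = f y"
  using poly_funs_le_eq[of p p] by blast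

lemma sum_fun_apply: "(\<Sum>i\<in>I. f i) x = (\<Sum>i\<in>I. f i x)" for f :: "_ \<Rightarrow> _ \<Rightarrow> real"
  by (induction I rule: infinite_finite_induct) auto

lemma poly_funs_sum:
  "(\<And>i. i \<in> I \<Longrightarrow> f i \<in> poly_funs m) \<Longrightarrow> (\<lambda>x. \<Sum>i\<in>I. f i x) \<in> poly_funs m"
  by (induction I rule: infinite_finite_induct) (auto intro: poly_funs.intros)

lemma subspace_poly_funs: "real_fun.subspace (poly_funs m)"
  using poly_funs.const[of _ m] poly_funs.add[of _ m] poly_funs.mult[OF poly_funs.const, of _ m]
  by (auto simp: real_fun.subspace_def scale_fun_def zero_fun_def plus_fun_def)

lemma GL_act_poly_funs:
  assumes "f \<in> poly_funs m"
  shows "GL_act m \<gamma> f \<in> poly_funs m"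
  using assms
proof induction
  case (linear i \<phi>)
  have "GL_act m \<gamma> (\<lambda>x. \<phi> (x i)) = (\<lambda>x. \<Sum>k<m. \<gamma> $$ (k, i) * \<phi> (x k))"
    using linear by (simp add: GL_act_def right_mult_def linear_sum linear_cmul)
  moreover have "\<dots> \<in> poly_funs m"
    using linear by (intro poly_funs_sum poly_funs.mult poly_funs.const poly_funs.linear) auto
  ultimately show ?case by simp
qed (auto simp: GL_act_def intro: poly_funs.intros)

section \<open>Right multiplication as an action, and the groups \<open>GL m\<close> and
  \<open>U m\<close>\<close>

lemma right_mult_right_mult:
  assumes "\<gamma> \<in> carrier_mat m m" "\<delta> \<in> carrier_mat m m"
  shows "right_mult m (right_mult m x \<gamma>) \<delta> = right_mult m x (\<gamma> * \<delta>)"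
proof
  fix j
  show "right_mult m (right_mult m x \<gamma>) \<delta> j = right_mult m x (\<gamma> * \<delta>) j"
  proof (cases "j < m")
    case True
    have "right_mult m (right_mult m x \<gamma>) \<delta> j
        = (\<Sum>i<m. \<Sum>k<m. (\<delta> $$ (i, j) * \<gamma> $$ (k, i)) *\<^sub>R x k)"
      using True by (simp add: right_mult_def scaleR_sum_right)
    also have "\<dots> = (\<Sum>k<m. \<Sum>i<m. (\<delta> $$ (i, j) * \<gamma> $$ (k, i)) *\<^sub>R x k)"
      by (rule sum.swap)
    also have "\<dots> = (\<Sum>k<m. (\<gamma> * \<delta>) $$ (k, j) *\<^sub>R x k)"
      using assms True
      by (intro sum.cong)
        (auto simp: scalar_prod_def scaleR_sum_left mult.commute atLeast0LessThan intro!: sum.cong)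
    finally show ?thesis using True by (simp add: right_mult_def)
  qed (simp add: right_mult_def)
qed

lemma GL_act_GL_act:
  "\<gamma> \<in> GL m \<Longrightarrow> \<delta> \<in> GL m \<Longrightarrow> GL_act m \<gamma> (GL_act m \<delta> f) = GL_act m (\<gamma> * \<delta>) f"
  by (simp add: GL_act_def GL_def right_mult_right_mult)

lemma GL_act_one: "f \<in> poly_funs m \<Longrightarrow> GL_act m (1\<^sub>m m) f = f"
  unfolding GL_act_def
  by (intro ext poly_funs_cong[of f m])
    (auto simp: right_mult_def if_distrib[of "\<lambda>c. c *\<^sub>R _"] cong: if_cong)

text \<open>\<open>invertible_mat\<close> does not state the dimensions of the inverse; they follow
  by comparing dimensions in the two identities. An inverse in the carrier is the form that products
  and transposes need.\<close>

lemma GL_altdef: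
  "GL m = {\<gamma> \<in> carrier_mat m m. \<exists>\<delta>\<in>carrier_mat m m. \<gamma> * \<delta> = 1\<^sub>m m \<and> \<delta> * \<gamma> = 1\<^sub>m m}"
proof (intro equalityI subsetI)
  fix \<gamma> :: "real mat"
  assume "\<gamma> \<in> GL m"
  then obtain \<delta> where g: "\<gamma> \<in> carrier_mat m m"
    and d: "\<gamma> * \<delta> = 1\<^sub>m m" "\<delta> * \<gamma> = 1\<^sub>m (dim_row \<delta>)"
    by (auto simp: GL_def invertible_mat_def inverts_mat_def)
  have "dim_col \<delta> = m" using arg_cong[OF d(1), of dim_col] by simp
  moreover have "dim_row \<delta> = m" using arg_cong[OF d(2), of dim_col] g by simp
  ultimately have "\<delta> \<in> carrier_mat m m" by auto
  then show "\<gamma> \<in> {\<gamma> \<in> carrier_mat m m. \<exists>\<delta>\<in>carrier_mat m m. \<gamma> * \<delta> = 1\<^sub>m m \<and> \<delta> * \<gamma> = 1\<^sub>m m}"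
    using g d by auto
qed (auto simp: GL_def invertible_mat_def inverts_mat_def)

lemma one_mem_GL: "1\<^sub>m m \<in> GL m"
  by (auto simp: GL_altdef intro!: bexI[of _ "1\<^sub>m m"])

lemma mult_mem_GL:
  assumes "\<gamma> \<in> GL m" "\<delta> \<in> GL m"
  shows "\<gamma> * \<delta> \<in> GL m"
proof -
  obtain \<gamma>' \<delta>' where g: "\<gamma> \<in> carrier_mat m m" "\<gamma>' \<in> carrier_mat m m"
      "\<gamma> * \<gamma>' = 1\<^sub>m m" "\<gamma>' * \<gamma> = 1\<^sub>m m"
    and d: "\<delta> \<in> carrier_mat m m" "\<delta>' \<in> carrier_mat m m"
      "\<delta> * \<delta>' = 1\<^sub>m m" "\<delta>' * \<delta> = 1\<^sub>m m"
    using assms by (auto simp: GL_altdef)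
  have "(\<gamma> * \<delta>) * (\<delta>' * \<gamma>') = \<gamma> * ((\<delta> * \<delta>') * \<gamma>')"
    using g(1,2) d(1,2) by (simp add: assoc_mult_mat[of _ m m _ m _ m])
  moreover have "(\<delta>' * \<gamma>') * (\<gamma> * \<delta>) = \<delta>' * ((\<gamma>' * \<gamma>) * \<delta>)"
    using g(1,2) d(1,2) by (simp add: assoc_mult_mat[of _ m m _ m _ m])
  ultimately have "(\<gamma> * \<delta>) * (\<delta>' * \<gamma>') = 1\<^sub>m m" "(\<delta>' * \<gamma>') * (\<gamma> * \<delta>) = 1\<^sub>m m"
    using g d by simp_all
  moreover have "\<gamma> * \<delta> \<in> carrier_mat m m" "\<delta>' * \<gamma>' \<in> carrier_mat m m"
    using g d by simp_all
  ultimately show ?thesis unfolding GL_altdef by blast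
qed

lemma transpose_mem_GL:
  assumes "\<gamma> \<in> GL m"
  shows "\<gamma>\<^sup>T \<in> GL m"
proof -
  obtain \<delta> where "\<gamma> \<in> carrier_mat m m" "\<delta> \<in> carrier_mat m m"
      "\<gamma> * \<delta> = 1\<^sub>m m" "\<delta> * \<gamma> = 1\<^sub>m m"
    using assms by (auto simp: GL_altdef)
  then show ?thesis
    by (auto simp: GL_altdef simp flip: transpose_mult intro!: bexI[of _ "\<delta>\<^sup>T"])
qed

text \<open>The determinant is the product of the diagonal, hence nonzero. This spares the later
  matrices an explicit inverse.\<close>

lemma unitriangular_mem_U:
  fixes \<gamma> :: "real mat"
  assumes "\<gamma> \<in> carrier_mat m m" "upper_triangular \<gamma>" "\<forall>i<m. \<gamma> $$ (i, i) = 1"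
  shows "\<gamma> \<in> U m"
proof -
  have "diag_mat \<gamma> = replicate m 1"
    using assms by (intro nth_equalityI) (auto simp: diag_mat_def)
  then have "Determinant.det \<gamma> \<noteq> 0"
    using det_upper_triangular[OF assms(2,1)] by simp
  then have "\<gamma> \<in> Units (ring_mat TYPE(real) m ())"
    by (rule det_non_zero_imp_unit[OF assms(1)])
  then have "\<gamma> \<in> GL m"
    by (auto simp: GL_altdef Units_def ring_mat_def)
  then show ?thesis using assms by (simp add: U_def)
qed

section \<open>Stability of invariants and of spans under \<open>GL m\<close>\<close>

lemma subspace_G_invs: "real_fun.subspace (G_invs G \<rho> m)"
  using subspace_poly_funs[of m]
  by (auto simp: real_fun.subspace_def G_invs_def G_act_def scale_fun_def fun_eq_iff)

lemma subspace_GL_span: "real_fun.subspace (GL_span m S)"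
  by (simp add: GL_span_def real_fun.subspace_span)

lemma GL_act_scale: "GL_act m \<gamma> (scale_fun c f) = scale_fun c (GL_act m \<gamma> f)"
  by (simp add: GL_act_def scale_fun_def)

lemma GL_act_add: "GL_act m \<gamma> (f + g) = GL_act m \<gamma> f + GL_act m \<gamma> g"
  by (simp add: GL_act_def plus_fun_def)

lemma GL_act_zero: "GL_act m \<gamma> 0 = 0"
  by (simp add: GL_act_def zero_fun_def)

lemma GL_act_GL_span:
  assumes "\<gamma> \<in> GL m" "f \<in> GL_span m S"
  shows "GL_act m \<gamma> f \<in> GL_span m S"
  using assms(2) unfolding GL_span_def
proof (induction rule: real_fun.span_induct_alt)
  case base
  show ?case by (simp only: GL_act_zero real_fun.span_zero)
next
  case (step c g h)
  then obtain \<delta> f where "\<delta> \<in> GL m" "f \<in> S" "g = GL_act m \<delta> f" by auto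
  then have "GL_act m \<gamma> g \<in> {GL_act m \<gamma> f |\<gamma> f. \<gamma> \<in> GL m \<and> f \<in> S}"
    using assms(1) GL_act_GL_act mult_mem_GL by blast
  then show ?case
    unfolding GL_act_add GL_act_scale
    by (intro real_fun.span_add real_fun.span_scale real_fun.span_base step.IH)
qed

text \<open>The two actions commute: a linear map applied to all vectors passes through the linear
  combinations that form the columns of \<open>right_mult\<close>.\<close>

lemma GL_act_G_invs:
  assumes "f \<in> G_invs G \<rho> m" "\<And>A. A \<in> G \<Longrightarrow> linear (\<rho> (matrix_inv A))"
  shows "GL_act m \<gamma> f \<in> G_invs G \<rho> m"
proof -
  have "G_act \<rho> A (GL_act m \<gamma> f) = GL_act m \<gamma> f" if A: "A \<in> G" for A
  proof
    fix x
    have "right_mult m (\<lambda>i. \<rho> (matrix_inv A) (x i)) \<gamma> = (\<lambda>i. \<rho> (matrix_inv A) (right_mult m x \<gamma> i))"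
      using assms(2)[OF A] by (auto simp: right_mult_def linear_sum linear_cmul)
    then have "G_act \<rho> A (GL_act m \<gamma> f) x = G_act \<rho> A f (right_mult m x \<gamma>)"
      by (simp add: G_act_def GL_act_def)
    also have "\<dots> = GL_act m \<gamma> f x"
      using assms(1) A by (simp add: G_invs_def GL_act_def)
    finally show "G_act \<rho> A (GL_act m \<gamma> f) x = GL_act m \<gamma> f x" .
  qed
  then show ?thesis
    using assms(1) GL_act_poly_funs by (auto simp: G_invs_def)
qed

lemma GL_span_subset:
  assumes "S \<subseteq> T" "real_fun.subspace T" "\<And>\<gamma> f. \<gamma> \<in> GL m \<Longrightarrow> f \<in> T \<Longrightarrow> GL_act m \<gamma> f \<in> T"
  shows "GL_span m S \<subseteq> T"
  unfolding GL_span_def by (rule real_fun.span_minimal) (use assms in auto)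

lemma subset_GL_span:
  assumes "S \<subseteq> poly_funs m"
  shows "S \<subseteq> GL_span m S"
proof
  fix f assume "f \<in> S"
  then have "f = GL_act m (1\<^sub>m m) f" using GL_act_one assms by fastforce
  then show "f \<in> GL_span m S"
    unfolding GL_span_def using \<open>f \<in> S\<close> one_mem_GL by (intro real_fun.span_base) blast
qed

lemma GL_span_mono: "S \<subseteq> T \<Longrightarrow> GL_span m S \<subseteq> GL_span m T"
  unfolding GL_span_def by (rule real_fun.span_mono) blast

section \<open>Tensor coefficients of polynomial functions\<close>

text \<open>A letter \<open>(i, b)\<close> stands for the \<open>b\<close>-coordinate of the \<open>i\<close>-th vector. Words that are
  permutations of each other give the same monomial, so coefficients are not unique; this is harmless
  and makes the group act by tensor powers.\<close>

definition monomial_fun ::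
    "'v::real_vector set \<Rightarrow> (nat \<times> 'v) list \<Rightarrow> (nat \<Rightarrow> 'v) \<Rightarrow> real" where
  "monomial_fun B L x = (\<Prod>(i, b)\<leftarrow>L. representation B (x i) b)"

text \<open>The bound on the length keeps the index set finite for finite \<open>B\<close>, so that
  orthogonal projection is available.\<close>

definition words :: "nat \<Rightarrow> 'v set \<Rightarrow> nat \<Rightarrow> (nat \<times> 'v) list set" where
  "words m B d = {L. set L \<subseteq> {..<m} \<times> B \<and> length L \<le> d}"

definition tensor_poly ::
    "nat \<Rightarrow> 'v::real_vector set \<Rightarrow> nat \<Rightarrow> ((nat \<times> 'v) list \<Rightarrow> real) \<Rightarrow> (nat \<Rightarrow> 'v) \<Rightarrow> real" where
  "tensor_poly m B d a = (\<lambda>x. \<Sum>L\<in>words m B d. a L * monomial_fun B L x)"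

text \<open>The matrix, in the basis of words, of the sum of the tensor powers of \<gamma> tensored
  with the identity on coordinates of V.\<close>

fun tensor_entry :: "real mat \<Rightarrow> (nat \<times> 'v) list \<Rightarrow> (nat \<times> 'v) list \<Rightarrow> real" where
  "tensor_entry \<gamma> [] [] = 1"
| "tensor_entry \<gamma> ((i, b) # K) ((j, c) # L) =
     (if b = c then \<gamma> $$ (i, j) else 0) * tensor_entry \<gamma> K L"
| "tensor_entry \<gamma> _ _ = 0"

definition tensor_act ::
    "nat \<Rightarrow> 'v set \<Rightarrow> nat \<Rightarrow> real mat \<Rightarrow> ((nat \<times> 'v) list \<Rightarrow> real) \<Rightarrow> (nat \<times> 'v) list \<Rightarrow> real" where
  "tensor_act m B d \<gamma> a = (\<lambda>K. \<Sum>L\<in>words m B d. tensor_entry \<gamma> K L * a L)"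

text \<open>The filtration for which \<open>U m\<close> acts unitriangularly on coefficients: the
  action of \<gamma> moves a coefficient only to words of smaller weight, apart from fixing its own
  place.\<close>

definition weight :: "(nat \<times> 'v) list \<Rightarrow> nat" where
  "weight L = sum_list (map fst L)"

lemma finite_words: "finite B \<Longrightarrow> finite (words m B d)"
  unfolding words_def by (rule finite_lists_length_le) simp

lemma tensor_entry_length: "length K \<noteq> length L \<Longrightarrow> tensor_entry \<gamma> K L = 0"
  by (induction \<gamma> K L rule: tensor_entry.induct) auto

text \<open>Here words pay off: with coefficients indexed by commutative monomials, multinomial
  factors would spoil this symmetry.\<close>

lemma tensor_entry_transpose:
  assumes "\<gamma> \<in> carrier_mat m m" "set K \<subseteq> {..<m} \<times> B" "set L \<subseteq> {..<m} \<times> B"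
  shows "tensor_entry (\<gamma>\<^sup>T) K L = tensor_entry \<gamma> L K"
  using assms by (induction \<gamma> K L rule: tensor_entry.induct) auto

text \<open>A nonzero entry is a product of nonzero \<open>\<gamma> $$ (i, j)\<close>, so
  \<open>i \<le> j\<close> at every position. Equal weights then force \<open>i = j\<close> at every
  position, and the coordinates agree anyway.\<close>

lemma tensor_entry_unitriangular:
  assumes "\<gamma> \<in> U m" "set K \<subseteq> {..<m} \<times> B" "set L \<subseteq> {..<m} \<times> B" "tensor_entry \<gamma> K L \<noteq> 0"
  shows "weight K \<le> weight L" "weight K = weight L \<Longrightarrow> K = L"
proof -
  have "weight K \<le> weight L \<and> (weight K = weight L \<longrightarrow> K = L)"
    using assms
  proof (induction \<gamma> K L rule: tensor_entry.induct)
    case (2 \<gamma> i b K j c L)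
    have "i \<le> j"
    proof (rule ccontr)
      assume "\<not> i \<le> j"
      then have "\<gamma> $$ (i, j) = 0"
        using 2 by (auto simp: U_def GL_def)
      then show False using 2(5) by (simp split: if_splits)
    qed
    then show ?case using 2 by (auto simp: weight_def split: if_splits)
  qed (auto simp: weight_def)
  then show "weight K \<le> weight L" "weight K = weight L \<Longrightarrow> K = L" by auto
qed

lemma tensor_entry_diagonal:
  assumes "\<gamma> \<in> U m" "set K \<subseteq> {..<m} \<times> B"
  shows "tensor_entry \<gamma> K K = 1"
  using assms(2) by (induction K) (use assms(1) in \<open>auto simp: U_def\<close>)

lemma inner_tensor_act:
  assumes "\<gamma> \<in> carrier_mat m m"
  shows "(\<Sum>K\<in>words m B d. tensor_act m B d \<gamma> a K * b K)
       = (\<Sum>K\<in>words m B d. a K * tensor_act m B d (\<gamma>\<^sup>T) b K)"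
proof -
  have "(\<Sum>K\<in>words m B d. tensor_act m B d \<gamma> a K * b K)
      = (\<Sum>K\<in>words m B d. \<Sum>L\<in>words m B d. tensor_entry \<gamma> K L * a L * b K)"
    by (simp add: tensor_act_def sum_distrib_right)
  also have "\<dots> = (\<Sum>L\<in>words m B d. \<Sum>K\<in>words m B d. tensor_entry \<gamma> K L * a L * b K)"
    by (rule sum.swap)
  also have "\<dots> = (\<Sum>L\<in>words m B d. a L * tensor_act m B d (\<gamma>\<^sup>T) b L)"
    using assms
    by (auto simp: tensor_act_def sum_distrib_left words_def tensor_entry_transpose[of _ m _ B]
        intro!: sum.cong)
  finally show ?thesis .
qed

text \<open>Each letter \<open>(j, c)\<close> becomes a linear combination of the letters
  \<open>(i, c)\<close> with coefficients \<open>\<gamma> $$ (i, j)\<close>; multiplying these out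
  yields words of the same length.\<close>

lemma monomial_fun_right_mult:
  assumes "finite B" "independent B" "span B = UNIV" "set L \<subseteq> {..<m} \<times> B"
  shows "monomial_fun B L (right_mult m x \<gamma>)
       = (\<Sum>K | set K \<subseteq> {..<m} \<times> B \<and> length K = length L. tensor_entry \<gamma> K L * monomial_fun B K x)"
  using assms(4)
proof (induction L)
  case Nil
  have "{K. K = [] \<and> set K \<subseteq> {..<m} \<times> B} = {[]}" by auto
  then show ?case by (simp add: monomial_fun_def)
next
  case (Cons p L)
  obtain j c where p: "p = (j, c)" by fastforce
  let ?P = "{..<m} \<times> B"
  let ?W = "{K. set K \<subseteq> ?P \<and> length K = length L}"
  let ?k = "\<lambda>q. (if snd q = c then \<gamma> $$ (fst q, j) else 0)"
  have j: "j < m" "c \<in> B" using Cons.prems p by auto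
  have "representation B (right_mult m x \<gamma> j) c = (\<Sum>i<m. \<gamma> $$ (i, j) * representation B (x i) c)"
    using j assms by (simp add: right_mult_def real_vector.representation_sum
        real_vector.representation_scale)
  \<comment> \<open>The sum is spread over all letters, with zero coefficients at the wrong
    coordinates, so that the product below runs over all words.\<close>
  also have "\<dots> = (\<Sum>q\<in>?P. ?k q * representation B (x (fst q)) (snd q))"
    using j assms(1)
    by (simp add: sum.cartesian_product' if_distrib[of "\<lambda>t. t * _"] cong: if_cong)
  finally have rep: "representation B (right_mult m x \<gamma> j) c
      = (\<Sum>q\<in>?P. ?k q * representation B (x (fst q)) (snd q))" .
  have "monomial_fun B (p # L) (right_mult m x \<gamma>)
      = (\<Sum>q\<in>?P. ?k q * representation B (x (fst q)) (snd q))
        * (\<Sum>K\<in>?W. tensor_entry \<gamma> K L * monomial_fun B K x)"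
    using Cons rep p by (simp add: monomial_fun_def)
  also have "\<dots> = (\<Sum>K\<in>?W. \<Sum>q\<in>?P. tensor_entry \<gamma> (q # K) (p # L) * monomial_fun B (q # K) x)"
    unfolding sum_product
    by (subst sum.swap) (auto simp: p monomial_fun_def intro!: sum.cong)
  also have "\<dots> = (\<Sum>(K, q)\<in>?W \<times> ?P. tensor_entry \<gamma> (q # K) (p # L) * monomial_fun B (q # K) x)"
    by (simp add: sum.cartesian_product)
  also have "\<dots> = (\<Sum>K | set K \<subseteq> ?P \<and> length K = length (p # L).
      tensor_entry \<gamma> K (p # L) * monomial_fun B K x)"
    unfolding list.size(4) One_nat_def add_Suc_right add_0_right lists_length_Suc_eq
    by (subst sum.reindex) (auto simp: inj_on_def case_prod_unfold)
  finally show ?case .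
qed

text \<open>The previous expansion extended linearly: \<open>tensor_poly\<close> is equivariant.
  Words whose length differs from that of \<open>L\<close> contribute zero entries, so the bound
  \<open>d\<close> is harmless.\<close>

lemma tensor_poly_tensor_act:
  assumes "finite B" "independent B" "span B = UNIV"
  shows "tensor_poly m B d (tensor_act m B d \<gamma> a) = GL_act m \<gamma> (tensor_poly m B d a)"
proof
  fix x
  have *: "(\<Sum>K\<in>words m B d. tensor_entry \<gamma> K L * monomial_fun B K x)
      = monomial_fun B L (right_mult m x \<gamma>)" if L: "L \<in> words m B d" for L
  proof -
    have "(\<Sum>K\<in>words m B d. tensor_entry \<gamma> K L * monomial_fun B K x)
        = (\<Sum>K | set K \<subseteq> {..<m} \<times> B \<and> length K = length L. tensor_entry \<gamma> K L * monomial_fun B K x)"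
      using L tensor_entry_length[of _ L \<gamma>] finite_words[OF assms(1)]
      by (intro sum.mono_neutral_right) (fastforce simp: words_def)+
    then show ?thesis
      using monomial_fun_right_mult[OF assms, of L m x \<gamma>] L by (simp add: words_def)
  qed
  have "tensor_poly m B d (tensor_act m B d \<gamma> a) x
      = (\<Sum>K\<in>words m B d. \<Sum>L\<in>words m B d. a L * (tensor_entry \<gamma> K L * monomial_fun B K x))"
    by (simp add: tensor_poly_def tensor_act_def sum_distrib_left sum_distrib_right mult_ac)
  also have "\<dots> = (\<Sum>L\<in>words m B d. a L * (\<Sum>K\<in>words m B d. tensor_entry \<gamma> K L * monomial_fun B K x))"
    by (subst sum.swap) (simp add: sum_distrib_left)
  also have "\<dots> = GL_act m \<gamma> (tensor_poly m B d a) x"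
    using * by (simp add: GL_act_def tensor_poly_def)
  finally show "tensor_poly m B d (tensor_act m B d \<gamma> a) x = GL_act m \<gamma> (tensor_poly m B d a) x" .
qed

section \<open>Linearity of \<open>tensor_poly\<close> and existence of tensor coefficients\<close>

lemma tensor_poly_add: "tensor_poly m B d (a + b) = tensor_poly m B d a + tensor_poly m B d b"
  by (simp add: tensor_poly_def plus_fun_def algebra_simps sum.distrib)

lemma tensor_poly_scale: "tensor_poly m B d (scale_fun c a) = scale_fun c (tensor_poly m B d a)"
  by (simp add: tensor_poly_def scale_fun_def sum_distrib_left mult_ac)

lemma tensor_poly_zero: "tensor_poly m B d 0 = 0"
  by (simp add: tensor_poly_def zero_fun_def)

lemma tensor_poly_cong:
  "(\<And>L. L \<in> words m B d \<Longrightarrow> a L = b L) \<Longrightarrow> tensor_poly m B d a = tensor_poly m B d b"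
  by (simp add: tensor_poly_def)

lemma tensor_poly_mem_poly_funs:
  assumes "finite B" "independent B" "span B = UNIV"
  shows "tensor_poly m B d a \<in> poly_funs m"
proof -
  have "monomial_fun B L \<in> poly_funs m" if "set L \<subseteq> {..<m} \<times> B" for L
    using that
  proof (induction L)
    case Nil
    then show ?case by (simp add: monomial_fun_def poly_funs.const)
  next
    case (Cons p L)
    have "linear (\<lambda>v. representation B v (snd p))"
      using real_vector.linear_representation[OF assms(2,3)]
      by (simp add: linear_def real_scaleR_def[abs_def])
    then have "(\<lambda>x. representation B (x (fst p)) (snd p) * monomial_fun B L x) \<in> poly_funs m"
      using Cons by (intro poly_funs.mult poly_funs.linear) auto
    then show ?case by (simp add: monomial_fun_def case_prod_unfold)
  qed
  then show ?thesis
    unfolding tensor_poly_def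
    by (intro poly_funs_sum poly_funs.mult poly_funs.const) (auto simp: words_def)
qed

text \<open>Linear forms expand in coordinates, and the product of two monomials is the monomial of
  the concatenated word, so the span is closed under products.\<close>

lemma poly_funs_in_monomial_span:
  assumes "finite B" "independent B" "span B = UNIV" "f \<in> poly_funs m"
  shows "f \<in> real_fun.span (monomial_fun B ` {L. set L \<subseteq> {..<m} \<times> B})" (is "f \<in> real_fun.span ?M")
  using assms(4)
proof induction
  case (linear i \<phi>)
  have "(\<lambda>x. \<phi> (x i)) = (\<Sum>b\<in>B. scale_fun (\<phi> b) (monomial_fun B [(i, b)]))"
  proof
    fix x :: "nat \<Rightarrow> 'a"
    have "\<phi> (x i) = \<phi> (\<Sum>b\<in>B. representation B (x i) b *\<^sub>R b)"
      using assms by (simp add: real_vector.sum_representation_eq)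
    also have "\<dots> = (\<Sum>b\<in>B. scale_fun (\<phi> b) (monomial_fun B [(i, b)]) x)"
      using linear by (simp add: linear_sum linear_cmul scale_fun_def monomial_fun_def mult.commute)
    also have "\<dots> = (\<Sum>b\<in>B. scale_fun (\<phi> b) (monomial_fun B [(i, b)])) x"
      by (simp add: sum_fun_apply)
    finally show "\<phi> (x i) = (\<Sum>b\<in>B. scale_fun (\<phi> b) (monomial_fun B [(i, b)])) x" .
  qed
  moreover have "(\<Sum>b\<in>B. scale_fun (\<phi> b) (monomial_fun B [(i, b)])) \<in> real_fun.span ?M"
    using linear by (intro real_fun.span_sum real_fun.span_scale real_fun.span_base) auto
  ultimately show ?case by simp
next
  case (const c)
  have "(\<lambda>x. c) = scale_fun c (monomial_fun B [])"
    by (simp add: scale_fun_def monomial_fun_def)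
  moreover have "monomial_fun B [] \<in> ?M" by auto
  ultimately show ?case by (simp add: real_fun.span_scale real_fun.span_base)
next
  case (add f g)
  then show ?case using real_fun.span_add[of f ?M g] by (simp add: plus_fun_def)
next
  case (mult f g)
  have dist: "(\<lambda>x. (scale_fun c h + k) x * g x) = scale_fun c (\<lambda>x. h x * g x) + (\<lambda>x. k x * g x)"
    for c and h k g :: "(nat \<Rightarrow> 'a) \<Rightarrow> real"
    by (auto simp: scale_fun_def algebra_simps)
  \<comment> \<open>One factor at a time: first a monomial times an element of the span, then both
    factors in the span.\<close>
  have 1: "(\<lambda>x. h x * g x) \<in> real_fun.span ?M" if h: "h \<in> ?M" and g: "g \<in> real_fun.span ?M" for h g
    using g
  proof (induction rule: real_fun.span_induct_alt)
    case base
    have "(\<lambda>x. h x * 0 x) = 0" by (auto simp: zero_fun_def)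
    then show ?case by (simp add: real_fun.span_zero)
  next
    case (step c k l)
    then obtain K L where KL: "set K \<subseteq> {..<m} \<times> B" "set L \<subseteq> {..<m} \<times> B"
        "h = monomial_fun B L" "k = monomial_fun B K" using h by auto
    then have "(\<lambda>x. k x * h x) = monomial_fun B (K @ L)"
      by (auto simp: monomial_fun_def)
    moreover have "monomial_fun B (K @ L) \<in> ?M" using KL by auto
    ultimately have "(\<lambda>x. k x * h x) \<in> ?M" by simp
    then have "scale_fun c (\<lambda>x. k x * h x) + (\<lambda>x. l x * h x) \<in> real_fun.span ?M"
      using step by (simp add: real_fun.span_add real_fun.span_scale real_fun.span_base mult.commute)
    then show ?case
      using dist[of c k l h] by (simp add: mult.commute)
  qed
  have "(\<lambda>x. f x * g x) \<in> real_fun.span ?M" if "f \<in> real_fun.span ?M" for f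
    using that
  proof (induction rule: real_fun.span_induct_alt)
    case base
    have "(\<lambda>x. 0 x * g x) = 0" by (auto simp: zero_fun_def)
    then show ?case by (simp add: real_fun.span_zero)
  next
    case (step c k l)
    then show ?case
      unfolding dist using 1[OF _ mult.IH(2)]
      by (intro real_fun.span_add real_fun.span_scale) auto
  qed
  then show ?case using mult.IH(1) .
qed

lemma poly_funs_eq_tensor_poly:
  assumes "finite B" "independent B" "span B = UNIV" "f \<in> poly_funs m"
  shows "\<exists>d a. f = tensor_poly m B d a"
  using poly_funs_in_monomial_span[OF assms]
proof (induction rule: real_fun.span_induct_alt)
  case base
  then show ?case using tensor_poly_zero by metis
next
  case (step c g h)
  then obtain L d a where L: "set L \<subseteq> {..<m} \<times> B" "g = monomial_fun B L"
    and h: "h = tensor_poly m B d a" by auto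
  define d' where "d' = max d (length L)"
  \<comment> \<open>Raising the bound to \<open>d'\<close> brings in longer words, on which
    \<open>a\<close> is arbitrary; there it is replaced by zero.\<close>
  define a' where "a' = (\<lambda>K. if length K \<le> d then a K else 0)"
  have fin: "finite (words m B d')" using finite_words assms(1) .
  have "tensor_poly m B d' a' = h"
    unfolding h tensor_poly_def
    by (intro ext sum.mono_neutral_cong_right[OF fin]) (auto simp: words_def a'_def d'_def)
  moreover have "tensor_poly m B d' (\<lambda>K. if K = L then 1 else 0) = g"
  proof -
    have "L \<in> words m B d'" using L by (auto simp: words_def d'_def)
    then show ?thesis
      using fin L by (auto simp: tensor_poly_def if_distrib[of "\<lambda>t. t * _"] cong: if_cong)
  qed
  ultimately have "scale_fun c g + h
      = tensor_poly m B d' (scale_fun c (\<lambda>K. if K = L then 1 else 0) + a')"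
    by (simp add: tensor_poly_add tensor_poly_scale)
  then show ?case by blast
qed

section \<open>Spanning by unipotent invariants\<close>

text \<open>Complete reducibility and highest weight vectors in elementary form, for any stable
  subspace. Since \<open>tensor_poly\<close> is not injective, the argument uses preimages of
  \<open>W\<close> and of the span in the space of coefficients.\<close>

lemma subset_GL_span_U_invs:
  fixes W :: "((nat \<Rightarrow> 'v::real_vector) \<Rightarrow> real) set"
  assumes B: "finite (B :: 'v set)" "independent B" "span B = UNIV"
    and W: "real_fun.subspace W" "W \<subseteq> poly_funs m"
    and stable: "\<And>\<gamma> f. \<gamma> \<in> GL m \<Longrightarrow> f \<in> W \<Longrightarrow> GL_act m \<gamma> f \<in> W"
  shows "W \<subseteq> GL_span m (W \<inter> U_invs m)"
proof
  fix f assume f: "f \<in> W"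
  then obtain d a where a: "f = tensor_poly m B d a"
    using poly_funs_eq_tensor_poly[OF B] W by blast
  let ?S = "GL_span m (W \<inter> U_invs m)"
  let ?I = "words m B d"
  let ?T = "tensor_poly m B d"
  let ?act = "tensor_act m B d"
  have fin: "finite ?I" using finite_words B(1) .
  have pre: "real_fun.subspace {a. ?T a \<in> X}" if "real_fun.subspace X" for X
    using that by (auto simp: real_fun.subspace_def tensor_poly_add tensor_poly_scale tensor_poly_zero)
  have S_sub: "real_fun.subspace ?S" by (rule subspace_GL_span)
  have SW: "?S \<subseteq> W" by (rule GL_span_subset) (use W stable in auto)
  \<comment> \<open>The orthogonal complement of the preimage of the span, inside the preimage of
    \<open>W\<close>. The goal is that its members vanish on \<open>?I\<close>.\<close>
  define C where "C = {b. ?T b \<in> W \<and> (\<forall>t. ?T t \<in> ?S \<longrightarrow> (\<Sum>K\<in>?I. b K * t K) = 0)}"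
  have C_sub: "real_fun.subspace C"
    using pre[OF W(1)] unfolding C_def real_fun.subspace_def
    by (auto simp: scale_fun_def distrib_right sum.distrib mult.assoc simp flip: sum_distrib_left)
  have C_act: "?act \<gamma> b \<in> C" if g: "\<gamma> \<in> GL m" and b: "b \<in> C" for \<gamma> b
  proof -
    have "?T (?act \<gamma> b) \<in> W"
      unfolding tensor_poly_tensor_act[OF B] using stable[OF g] b by (simp add: C_def)
    moreover have "(\<Sum>K\<in>?I. ?act \<gamma> b K * t K) = 0" if "?T t \<in> ?S" for t
    proof -
      \<comment> \<open>The preimage of the span is stable under the transpose, to which the action
        moves in the inner product.\<close>
      have "?T (?act (\<gamma>\<^sup>T) t) \<in> ?S"
        unfolding tensor_poly_tensor_act[OF B]
        using GL_act_GL_span[OF transpose_mem_GL[OF g] that] .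
      then show ?thesis
        using b g inner_tensor_act[of \<gamma> m B d b t] by (simp add: C_def GL_def)
    qed
    ultimately show ?thesis by (simp add: C_def)
  qed
  \<comment> \<open>Induction on a strict upper bound \<open>k\<close> for the weights in the
    support of \<open>b\<close>.\<close>
  have C_zero: "\<forall>K\<in>?I. b K = 0" if "b \<in> C" "\<And>K. K \<in> ?I \<Longrightarrow> weight K \<ge> k \<Longrightarrow> b K = 0" for b k
    using that
  proof (induction k arbitrary: b)
    case (Suc k)
    \<comment> \<open>A unitriangular matrix fixes \<open>b\<close> modulo coefficients of smaller weight.\<close>
    have fixed: "?T (?act \<gamma> b) = ?T b" if g: "\<gamma> \<in> U m" for \<gamma>
    proof -
      have "?act \<gamma> b - b \<in> C"
        using C_sub C_act Suc.prems(1) g by (auto simp: U_def intro: real_fun.subspace_diff)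
      moreover have "(?act \<gamma> b - b) K = 0" if K: "K \<in> ?I" "weight K \<ge> k" for K
      proof -
        have "tensor_entry \<gamma> K L * b L = 0" if L: "L \<in> ?I - {K}" for L
        proof (rule ccontr)
          assume nz: "tensor_entry \<gamma> K L * b L \<noteq> 0"
          \<comment> \<open>Now \<open>weight L \<le> k \<le> weight K \<le> weight L\<close>, so
            the weights are equal and \<open>K = L\<close>, which was excluded.\<close>
          then have "weight L < Suc k" using Suc.prems(2)[of L] L by fastforce
          moreover have "weight K \<le> weight L" "weight K = weight L \<Longrightarrow> K = L"
            using tensor_entry_unitriangular[OF g, of K B L] K L nz by (auto simp: words_def)
          ultimately show False using K L by force
        qed
        then have "(\<Sum>L\<in>?I - {K}. tensor_entry \<gamma> K L * b L) = 0"
          by (intro sum.neutral) blast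
        then have "(\<Sum>L\<in>?I. tensor_entry \<gamma> K L * b L) = tensor_entry \<gamma> K K * b K"
          using sum.remove[OF fin K(1), of "\<lambda>L. tensor_entry \<gamma> K L * b L"] by simp
        also have "\<dots> = b K"
          using tensor_entry_diagonal[OF g, of K B] K by (simp add: words_def)
        finally show ?thesis by (simp add: tensor_act_def)
      qed
      \<comment> \<open>The difference lies in \<open>C\<close> with smaller weights, so it vanishes
        by induction and \<open>?T b\<close> is invariant under \<gamma>.\<close>
      ultimately have "\<forall>K\<in>?I. (?act \<gamma> b - b) K = 0" by (rule Suc.IH)
      then show ?thesis by (intro tensor_poly_cong) auto
    qed
    have "?T b \<in> W" using Suc.prems(1) by (simp add: C_def)
    moreover have "?T b \<in> U_invs m"
      using fixed tensor_poly_mem_poly_funs[OF B]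
      by (simp add: U_invs_def tensor_poly_tensor_act[OF B])
    ultimately have "?T b \<in> ?S"
      using subset_GL_span[of "W \<inter> U_invs m" m] W(2) by blast
    \<comment> \<open>Now \<open>b\<close> lies in the preimage of the span and in its complement,
      hence is orthogonal to itself.\<close>
    then have "(\<Sum>K\<in>?I. b K * b K) = 0" using Suc.prems(1) by (simp add: C_def)
    then show ?case using fin by (simp add: sum_nonneg_eq_0_iff)
  qed simp
  \<comment> \<open>The projection of \<open>a\<close> onto the preimage of the span; the residual
    \<open>a - s\<close> lies in \<open>C\<close>.\<close>
  obtain s where s: "?T s \<in> ?S" "\<And>t. ?T t \<in> ?S \<Longrightarrow> (\<Sum>K\<in>?I. (a K - s K) * t K) = 0"
    using subspace_orthogonal_projection[OF fin pre[OF S_sub], of a] by auto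
  have "a - s \<in> C"
    using s f SW real_fun.subspace_diff[OF pre[OF W(1)], of a s] by (auto simp: C_def a)
  moreover have "weight K < Suc (Max (weight ` ?I))" if "K \<in> ?I" for K
    using that fin by (simp add: less_Suc_eq_le)
  ultimately have "\<forall>K\<in>?I. (a - s) K = 0"
    using C_zero[of "a - s" "Suc (Max (weight ` ?I))"] by fastforce
  then have "?T a = ?T s" by (intro tensor_poly_cong) auto
  then show "f \<in> ?S" using s(1) a by simp
qed

section \<open>Unipotent invariants depend on at most $n$ vectors\<close>

lemma poly_funs_on_line:
  assumes "f \<in> poly_funs m"
  shows "\<exists>p. \<forall>s. f (\<lambda>i. x i + s *\<^sub>R y i) = poly p s"
  using assms
proof induction
  case (linear i \<phi>)
  then have "\<forall>s. \<phi> (x i + s *\<^sub>R y i) = poly [:\<phi> (x i), \<phi> (y i):] s"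
    by (simp add: linear_add linear_cmul)
  then show ?case by blast
next
  case (const c)
  have "\<forall>s. c = poly [:c:] s" by simp
  then show ?case by blast
next
  case (add f g)
  then show ?case by (metis poly_add)
next
  case (mult f g)
  then show ?case by (metis poly_mult)
qed

text \<open>On the line the difference is a polynomial in \<open>s\<close> with infinitely many
  roots, hence zero; the value at \<open>s = 0\<close> gives the claim.\<close>

lemma poly_funs_eq_if_eq_far_on_line:
  assumes "f \<in> poly_funs m" "g \<in> poly_funs m"
    and eq: "\<And>s. s > C \<Longrightarrow> f (\<lambda>i. x i + s *\<^sub>R y i) = g (\<lambda>i. x i + s *\<^sub>R y i)"
  shows "f x = g x"
proof -
  obtain p q where p: "\<And>s. f (\<lambda>i. x i + s *\<^sub>R y i) = poly p s"
    and q: "\<And>s. g (\<lambda>i. x i + s *\<^sub>R y i) = poly q s"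
    using poly_funs_on_line[OF assms(1), of x y] poly_funs_on_line[OF assms(2), of x y] by blast
  have "infinite {C<..}" by (rule infinite_Ioi)
  moreover have "{C<..} \<subseteq> {s. poly (p - q) s = 0}" using eq p q by auto
  ultimately have "p - q = 0"
    using poly_roots_finite finite_subset by blast
  then show ?thesis using p[of 0] q[of 0] by simp
qed

text \<open>For large \<open>s\<close> the linear map taking \<open>e i\<close> to \<open>x i + s *\<^sub>R e i\<close> is injective,
  because in coordinates its part \<open>s\<close> times the identity exceeds the sum of all entries of the rest.\<close>

lemma perturbed_basis_spans:
  fixes x :: "nat \<Rightarrow> 'v::real_vector"
  assumes "bij_betw e {..<n} B" and B: "finite B" "independent B" "span B = UNIV"
  shows "\<exists>C. \<forall>s>C. \<forall>v. \<exists>c. v = (\<Sum>i<n. c i *\<^sub>R (x i + s *\<^sub>R e i))"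
proof -
  let ?r = "representation B"
  \<comment> \<open>Supplies that an injective linear endomorphism is surjective.\<close>
  interpret fd: finite_dimensional_vector_space scaleR B
    using B by unfold_locales (simp_all add: dependent_raw_def span_raw_def)
  define C where "C = (\<Sum>i<n. \<Sum>j<n. \<bar>?r (x i) (e j)\<bar>)"
  have e: "e i \<in> B" if "i < n" for i using assms(1) that by (auto simp: bij_betw_def)
  have expand: "v = (\<Sum>i<n. ?r v (e i) *\<^sub>R e i)" for v
    using real_vector.sum_representation_eq[OF B(2), of v B] B
    by (simp add: sum.reindex_bij_betw[OF assms(1), of "\<lambda>b. ?r v b *\<^sub>R b"])
  have lin: "linear (\<lambda>v. ?r v b)" for b
    using real_vector.linear_representation[OF B(2,3)]
    by (simp add: linear_def real_scaleR_def[abs_def])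
  have "\<exists>c. v = (\<Sum>i<n. c i *\<^sub>R (x i + s *\<^sub>R e i))" if s: "s > C" for s v
  proof -
    define T where "T = (\<lambda>v. \<Sum>i<n. ?r v (e i) *\<^sub>R (x i + s *\<^sub>R e i))"
    have T: "linear T"
      unfolding T_def
      by (intro linearI) (simp_all add: linear_add[OF lin] linear_cmul[OF lin] scaleR_left_distrib
          sum.distrib scaleR_sum_right del: scaleR_right_distrib)
    have "v = 0" if "T v = 0" for v
    proof -
      have Tv: "T v = (\<Sum>i<n. ?r v (e i) *\<^sub>R x i) + s *\<^sub>R v"
      proof -
        have "s *\<^sub>R v = (\<Sum>i<n. s *\<^sub>R ?r v (e i) *\<^sub>R e i)"
          using arg_cong[OF expand[of v], of "\<lambda>v. s *\<^sub>R v"] by (simp add: scaleR_sum_right)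
        then show ?thesis
          by (simp add: T_def scaleR_right_distrib sum.distrib mult.commute)
      qed
      have coord: "s * ?r v (e j) = - (\<Sum>i<n. ?r v (e i) * ?r (x i) (e j))" for j
      proof -
        have "0 = ?r (T v) (e j)" using that by (simp add: real_vector.representation_zero)
        also have "\<dots> = (\<Sum>i<n. ?r v (e i) * ?r (x i) (e j)) + s * ?r v (e j)"
          unfolding Tv
          by (simp add: linear_add[OF lin] linear_cmul[OF lin] linear_sum[OF lin])
        finally show ?thesis by simp
      qed
      \<comment> \<open>The l1-norm of the coordinates of \<open>v\<close>. The estimate
        \<open>s * ?N \<le> C * ?N\<close> with \<open>s > C\<close> forces it to vanish.\<close>
      let ?N = "\<Sum>j<n. \<bar>?r v (e j)\<bar>"
      have "0 \<le> C" unfolding C_def by (intro sum_nonneg) auto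
      have "s * ?N = (\<Sum>j<n. \<bar>s * ?r v (e j)\<bar>)"
        using s \<open>0 \<le> C\<close> by (simp add: abs_mult sum_distrib_left)
      also have "\<dots> \<le> (\<Sum>j<n. \<Sum>i<n. \<bar>?r v (e i)\<bar> * \<bar>?r (x i) (e j)\<bar>)"
        unfolding coord abs_minus_cancel
        by (intro sum_mono order.trans[OF sum_abs]) (simp add: abs_mult)
      also have "\<dots> = (\<Sum>i<n. \<bar>?r v (e i)\<bar> * (\<Sum>j<n. \<bar>?r (x i) (e j)\<bar>))"
        by (subst sum.swap) (simp add: sum_distrib_left)
      also have "\<dots> \<le> (\<Sum>i<n. \<bar>?r v (e i)\<bar> * C)"
        unfolding C_def by (intro sum_mono mult_left_mono member_le_sum) (auto intro: sum_nonneg)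
      also have "\<dots> = C * ?N" by (simp add: sum_distrib_left mult.commute)
      finally have "(s - C) * ?N \<le> 0" by (simp add: algebra_simps)
      moreover have "?N \<ge> 0" by (intro sum_nonneg) auto
      ultimately have "?N = 0" using s by (simp add: mult_le_0_iff)
      then have "\<And>j. j < n \<Longrightarrow> ?r v (e j) = 0" by (simp add: sum_nonneg_eq_0_iff)
      then show "v = 0" using expand[of v] by simp
    qed
    then have "inj T" using linear_injective_0[OF T] by blast
    then have "surj T" using fd.linear_inj_imp_surj T by (simp add: linear_def)
    then obtain w where "v = T w" by (rule surjE)
    then show ?thesis unfolding T_def by (intro exI)
  qed
  then show ?thesis by blast
qed

text \<open>When the first n vectors span V, unitriangular column operations clear all later columns
  without changing \<open>f\<close>. Perturbing along a basis carries the resulting identity over to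
  all arguments.\<close>

lemma U_invs_subset_poly_funs:
  fixes B :: "'v::real_vector set"
  assumes B: "finite B" "independent B" "span B = UNIV" and "card B \<le> m"
  shows "(U_invs m :: ((nat \<Rightarrow> 'v) \<Rightarrow> real) set) \<subseteq> poly_funs (card B)"
proof
  fix f :: "(nat \<Rightarrow> 'v) \<Rightarrow> real" assume f: "f \<in> U_invs m"
  define n where "n = card B"
  have fm: "f \<in> poly_funs m" using f by (simp add: U_invs_def)
  let ?t = "\<lambda>(x::nat \<Rightarrow> 'v) i. if i < n then x i else 0"
  have ft: "(\<lambda>x. f (?t x)) \<in> poly_funs m"
    using fm
  proof induction
    case (linear i \<phi>)
    then show ?case by (cases "i < n") (simp_all add: poly_funs.linear poly_funs.const)
  qed (simp_all add: poly_funs.intros)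
  obtain e where e: "bij_betw e {..<n} B"
    using ex_bij_betw_nat_finite[OF B(1)] by (auto simp: n_def atLeast0LessThan)
  have kill: "f z = f (?t z)" if span: "\<And>v. \<exists>c. v = (\<Sum>i<n. c i *\<^sub>R z i)" for z
  proof -
    have "\<forall>j. \<exists>c. z j = (\<Sum>i<n. c i *\<^sub>R z i)" using span by blast
    from choice[OF this] obtain c where c: "\<And>j. z j = (\<Sum>i<n. c j i *\<^sub>R z i)" by blast
    \<comment> \<open>From each column \<open>j \<ge> n\<close> this subtracts its expansion in the
      first \<open>n\<close> columns, and it leaves those \<open>n\<close> columns alone.\<close>
    define \<gamma> where "\<gamma> = Matrix.mat m m
      (\<lambda>(i, j). if i = j then 1 else if i < n \<and> n \<le> j then - c j i else 0 :: real)"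
    have "\<gamma> \<in> U m" by (intro unitriangular_mem_U) (auto simp: \<gamma>_def)
    have "right_mult m z \<gamma> j = ?t z j" if j: "j < m" for j
    proof (cases "j < n")
      case True
      have "(\<Sum>i<m. \<gamma> $$ (i, j) *\<^sub>R z i) = (\<Sum>i<m. if i = j then z i else 0)"
        using j True by (intro sum.cong) (auto simp: \<gamma>_def)
      then show ?thesis using j True by (simp add: right_mult_def)
    next
      case False
      have "right_mult m z \<gamma> j = (\<Sum>i<m. \<gamma> $$ (i, j) *\<^sub>R z i)"
        using j by (simp add: right_mult_def)
      also have "\<dots> = (\<Sum>i<m. (if i = j then z i else 0) - (if i < n then c j i *\<^sub>R z i else 0))"
        using j False by (intro sum.cong) (auto simp: \<gamma>_def)
      also have "\<dots> = z j - (\<Sum>i<m. if i < n then c j i *\<^sub>R z i else 0)"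
        using j by (simp add: sum_subtractf)
      also have "(\<Sum>i<m. if i < n then c j i *\<^sub>R z i else 0) = (\<Sum>i<n. c j i *\<^sub>R z i)"
        using assms(4) by (intro sum.mono_neutral_cong_right) (auto simp: n_def)
      also have "z j - (\<Sum>i<n. c j i *\<^sub>R z i) = 0" using c[of j] by simp
      finally show ?thesis using False by simp
    qed
    then have "f (right_mult m z \<gamma>) = f (?t z)" by (intro poly_funs_cong[OF fm])
    moreover have "GL_act m \<gamma> f z = f z"
      using f \<open>\<gamma> \<in> U m\<close> by (simp add: U_invs_def)
    ultimately show ?thesis by (simp add: GL_act_def)
  qed
  have trunc: "f x = f (?t x)" for x
  proof -
    obtain C where C: "\<And>s v. s > C \<Longrightarrow> \<exists>c. v = (\<Sum>i<n. c i *\<^sub>R (x i + s *\<^sub>R e i))"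
      using perturbed_basis_spans[OF e B, of x] by blast
    show ?thesis
      \<comment> \<open>At far points of the line through \<open>x\<close> in direction
        \<open>e\<close> the first \<open>n\<close> vectors span V, so \<open>kill\<close> applies
        there.\<close>
      by (rule poly_funs_eq_if_eq_far_on_line[OF fm ft, of C x e], rule kill) (use C in blast)
  qed
  have "f x = f y" if "\<forall>i<n. x i = y i" for x y
  proof -
    have "?t x = ?t y" using that by auto
    then show ?thesis using trunc[of x] trunc[of y] by simp
  qed
  then show "f \<in> poly_funs (card B)"
    using fm poly_funs_le_eq[OF assms(4)] by (auto simp: n_def)
qed

text \<open>\<open>f\<close> sees only the first p columns of the product. For upper triangular
  matrices of size q these depend only on the upper left block of size p, which lies in
  \<open>U p\<close>; conversely, each member of \<open>U p\<close> is extended by an identity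
  block.\<close>

lemma U_invs_iff:
  fixes f :: "(nat \<Rightarrow> 'a::real_vector) \<Rightarrow> real"
  assumes "p \<le> q" "f \<in> poly_funs p"
  shows "f \<in> U_invs p \<longleftrightarrow> f \<in> U_invs q"
proof -
  have fq: "f \<in> poly_funs q" using assms poly_funs_mono by blast
  have act: "GL_act p \<gamma> f = GL_act q \<delta> f"
    if block: "\<And>i j. i < p \<Longrightarrow> j < p \<Longrightarrow> \<delta> $$ (i, j) = \<gamma> $$ (i, j)"
      \<comment> \<open>The lower left block vanishes, so the later vectors do not enter the first
        \<open>p\<close> columns.\<close>
      "\<And>i j. p \<le> i \<Longrightarrow> i < q \<Longrightarrow> j < p \<Longrightarrow> \<delta> $$ (i, j) = 0" for \<gamma> \<delta>
  proof
    fix x :: "nat \<Rightarrow> 'a"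
    have "right_mult p x \<gamma> j = right_mult q x \<delta> j" if j: "j < p" for j
    proof -
      have "(\<Sum>i<q. \<delta> $$ (i, j) *\<^sub>R x i) = (\<Sum>i<p. \<gamma> $$ (i, j) *\<^sub>R x i)"
        using j \<open>p \<le> q\<close> block
        by (intro sum.mono_neutral_cong_right) auto
      then show ?thesis using j \<open>p \<le> q\<close> by (simp add: right_mult_def)
    qed
    then show "GL_act p \<gamma> f x = GL_act q \<delta> f x"
      unfolding GL_act_def by (intro poly_funs_cong[OF assms(2)]) auto
  qed
  have "GL_act q \<delta> f = f" if f: "f \<in> U_invs p" and d: "\<delta> \<in> U q" for \<delta>
  proof -
    have d': "\<delta> \<in> carrier_mat q q" "upper_triangular \<delta>" "\<And>i. i < q \<Longrightarrow> \<delta> $$ (i, i) = 1"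
      using d by (auto simp: U_def GL_def)
    let ?g = "Matrix.mat p p (\<lambda>(i, j). \<delta> $$ (i, j))"
    have "?g \<in> U p"
      using d' \<open>p \<le> q\<close> by (intro unitriangular_mem_U) (auto simp: upper_triangular_def)
    moreover have "GL_act p ?g f = GL_act q \<delta> f"
      using d' by (intro act) auto
    ultimately show ?thesis using f by (simp add: U_invs_def)
  qed
  moreover have "GL_act p \<gamma> f = f" if f: "f \<in> U_invs q" and g: "\<gamma> \<in> U p" for \<gamma>
  proof -
    have g': "\<gamma> \<in> carrier_mat p p" "upper_triangular \<gamma>" "\<And>i. i < p \<Longrightarrow> \<gamma> $$ (i, i) = 1"
      using g by (auto simp: U_def GL_def)
    let ?d = "Matrix.mat q q (\<lambda>(i, j). if i < p \<and> j < p then \<gamma> $$ (i, j) else if i = j then 1 else 0)"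
    have "?d \<in> U q"
      using g' by (intro unitriangular_mem_U) (auto simp: upper_triangular_def)
    moreover have "GL_act p \<gamma> f = GL_act q ?d f"
      using \<open>p \<le> q\<close> by (intro act) auto
    ultimately show ?thesis using f by (simp add: U_invs_def)
  qed
  ultimately show ?thesis using assms(2) fq by (auto simp: U_invs_def)
qed

section \<open>The three claims on invariants of \<open>G\<close>\<close>

theorem theorem2:
  fixes G :: "(real^'r^'r) set"
    and \<rho> :: "real^'r^'r \<Rightarrow> 'v::real_vector \<Rightarrow> 'v"
    and n :: nat
  assumes "linear_group G"
    and "\<exists>B::'v set. finite B \<and> span B = UNIV"
    and "dim (UNIV :: 'v set) = n"
    and "rational_representation G \<rho>"
  shows "(\<forall>m\<ge>1. G_invs G \<rho> m = GL_span m (GU_invs G \<rho> m)) \<and>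
         (\<forall>m\<ge>1. (U_invs m :: ((nat \<Rightarrow> 'v) \<Rightarrow> real) set) = poly_funs m \<inter> U_invs n) \<and>
         (\<forall>m. (n \<le> m \<longrightarrow> G_invs G \<rho> m = GL_span m (G_invs G \<rho> n)) \<and>
              (m \<le> n \<longrightarrow> G_invs G \<rho> m = poly_funs m \<inter> G_invs G \<rho> n))"
proof -
  obtain B0 :: "'v set" where B0: "finite B0" "span B0 = UNIV" using assms(2) by blast
  obtain B where "B \<subseteq> B0" and B': "independent B" "B0 \<subseteq> span B"
    using real_vector.maximal_independent_subset[of B0] by metis
  then have B: "finite B" "independent B" "span B = UNIV"
    using B0 finite_subset span_mono[OF B'(2)] by (auto simp: span_span)
  have card: "card B = n"
    using real_vector.dim_eq_card[of B UNIV] B assms(3) by simp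
  have lin: "linear (\<rho> (matrix_inv A))" if "A \<in> G" for A
    using assms(1,4) that by (auto simp: linear_group_def rational_representation_def)
  \<comment> \<open>\<open>G_act\<close> is the same operator for every number of variables, so
    invariance does not depend on \<open>m\<close>. This is also the restriction half of
    (3).\<close>
  have mono: "poly_funs m \<inter> G_invs G \<rho> k = G_invs G \<rho> m" if "m \<le> k" for m k
    using poly_funs_mono[OF that] by (auto simp: G_invs_def)
  have GU: "GU_invs G \<rho> m = G_invs G \<rho> m \<inter> U_invs m" for m
    by (auto simp: GU_invs_def G_invs_def U_invs_def)
  have span_le: "GL_span m S \<subseteq> G_invs G \<rho> m" if "S \<subseteq> G_invs G \<rho> m" for m S
    using GL_act_G_invs[of _ G \<rho> m] lin by (intro GL_span_subset[OF that subspace_G_invs]) simp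
  have 1: "G_invs G \<rho> m = GL_span m (GU_invs G \<rho> m)" for m
    unfolding GU
  proof (rule equalityI)
    show "G_invs G \<rho> m \<subseteq> GL_span m (G_invs G \<rho> m \<inter> U_invs m)"
    proof (rule subset_GL_span_U_invs[OF B subspace_G_invs])
      show "GL_act m \<gamma> f \<in> G_invs G \<rho> m" if "f \<in> G_invs G \<rho> m" for \<gamma> f
        using GL_act_G_invs[OF that] lin by simp
    qed (auto simp: G_invs_def)
  qed (simp add: span_le)
  have 2: "(U_invs m :: ((nat \<Rightarrow> 'v) \<Rightarrow> real) set) = poly_funs m \<inter> U_invs n" for m
  proof (cases "m \<le> n")
    case True
    then show ?thesis using U_invs_iff[OF True] by (auto simp: U_invs_def)
  next
    case False
    \<comment> \<open>For more than \<open>n\<close> vectors, the invariants of \<open>U m\<close>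
      involve only the first \<open>n\<close>; comparing \<open>U n\<close> with \<open>U m\<close>
      then finishes.\<close>
    then have nm: "n \<le> m" by simp
    have "U_invs m \<subseteq> (poly_funs n :: ((nat \<Rightarrow> 'v) \<Rightarrow> real) set)"
      using U_invs_subset_poly_funs[OF B] nm card by blast
    moreover have "(U_invs n :: ((nat \<Rightarrow> 'v) \<Rightarrow> real) set) \<subseteq> poly_funs n"
      by (auto simp: U_invs_def)
    ultimately show ?thesis using U_invs_iff[OF nm] poly_funs_mono[OF nm] by blast
  qed
  have 3: "G_invs G \<rho> m = GL_span m (G_invs G \<rho> n)" if nm: "n \<le> m" for m
  proof (rule equalityI)
    \<comment> \<open>By (2) the generators from (1) involve only the first \<open>n\<close>
      vectors, so they are already \<open>n\<close>-ary invariants of \<open>G\<close>.\<close>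
    have "GU_invs G \<rho> m \<subseteq> G_invs G \<rho> n"
      using 2[of m] mono[OF nm] unfolding GU by (auto simp: U_invs_def)
    then show "G_invs G \<rho> m \<subseteq> GL_span m (G_invs G \<rho> n)"
      using 1 GL_span_mono by metis
    show "GL_span m (G_invs G \<rho> n) \<subseteq> G_invs G \<rho> m"
      using mono[OF nm] by (intro span_le) blast
  qed
  show ?thesis using 1 2 3 mono by blast
qed

end
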